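(* Let $a$ be a positive integer that is not a perfect square. Then there are infinitely many odd positive integers $n$ such that $a^{n}+1$ is not the sum of two squares.
   Context: An integer $N$ is "the sum of two squares" if $N = s^2+t^2$ for some integers $s,t$ (zero is allowed). *)

theory Defs
  imports Complex_Main "HOL-Computational_Algebra.Nth_Powers"
begin

definition sum_of_two_squares :: "int \<Rightarrow> bool" where
  "sum_of_two_squares N \<longleftrightarrow> (\<exists>s t :: int. N = s ^ 2 + t ^ 2)"

end

theory Submission
  imports Defs "HOL-Number_Theory.Number_Theory" "HOL-Analysis.Harmonic_Numbers"
begin

text \<open>
  A nonzero sum of two squares contains every prime \<open>p \<equiv> 3 (mod 4)\<close> to an even power
  (\<open>multiplicity_sum_of_two_squares_even\<close>), so it suffices to find odd exponents \<open>n\<close> for which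
  \<open>a ^ n + 1\<close> contains some fixed such \<open>p\<close> to an odd power. If \<open>a\<close> is a non-residue modulo
  \<open>p \<equiv> 3 (mod 4)\<close>, then \<open>m = (p - 1) / 2\<close> is odd and Euler's criterion gives \<open>p\<close> dividing
  \<open>a ^ m + 1\<close>. Replacing \<open>m\<close> by \<open>m * p\<close> raises the multiplicity of \<open>p\<close> by exactly one, so one of
  \<open>m\<close> and \<open>m * p\<close> has an odd multiplicity; multiplying that exponent by odd numbers prime to \<open>p\<close> does
  not change the multiplicity, and infinitely many exponents result
  (\<open>infinitely_many_exponents\<close>).

  The heart of the matter is therefore the existence of a prime \<open>p \<equiv> 3 (mod 4)\<close> modulo which the
  non-square \<open>a\<close> is a non-residue (\<open>inert_prime_exists\<close>). Factors \<open>4\<close> of \<open>a\<close> can be removed. If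
  \<open>a\<close> is \<open>2\<close> or \<open>3\<close> modulo \<open>4\<close>, then \<open>1 + a\<close> or \<open>4 + a\<close> is \<open>3\<close> modulo \<open>4\<close> and so has a prime
  factor \<open>p \<equiv> 3 (mod 4)\<close>, modulo which \<open>-a\<close> is a square and \<open>-1\<close> is not. If \<open>a \<equiv> 1 (mod 4)\<close>,
  quadratic reciprocity turns the question into one about two nonprincipal quadratic characters
  \<open>f\<close> and \<open>g\<close> of the same modulus: find a prime at which both are \<open>-1\<close>.

  Such a prime always exists (\<open>common_prime_value_minus_one\<close>). If there were none, the Dirichlet
  convolution \<open>r\<close> of \<open>f\<close> and \<open>g\<close> would be nonnegative, and at least \<open>1\<close> at squares prime to the modulus,
  as a look at prime powers shows. The sum of \<open>r n / sqrt n\<close> over \<open>n \<le> N\<^sup>2\<close> would then dominate a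
  harmonic sum. But the hyperbola method bounds it independently of \<open>N\<close>, because sums of \<open>f\<close> and
  of \<open>g\<close> over intervals are bounded.
\<close>

section \<open>Summation under the hyperbola\<close>

text \<open>
  Summation by parts: the weighted sum differs from \<open>T B * w B\<close>, where \<open>T\<close> is the partial sum of \<open>c\<close>,
  by terms \<open>T n * (w n - w (n + 1))\<close>, and the weights in these telescope.
\<close>
lemma Abel_inequality:
  fixes c w :: "nat \<Rightarrow> real"
  assumes bound: "\<And>B. \<bar>\<Sum>n\<in>{A<..B}. c n\<bar> \<le> K"
    and w0: "\<And>n. 0 \<le> w n" and dec: "\<And>n. A < n \<Longrightarrow> w (Suc n) \<le> w n"
  shows "\<bar>\<Sum>n\<in>{A<..B}. c n * w n\<bar> \<le> K * w (Suc A)"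
proof -
  have K0: "0 \<le> K" using bound[of 0] by simp
  define T where "T B = (\<Sum>n\<in>{A<..B}. c n)" for B
  have T: "\<bar>T B\<bar> \<le> K" for B unfolding T_def by (rule bound)
  show ?thesis
  proof (cases "B \<le> A")
    case True
    then show ?thesis using K0 w0[of "Suc A"] by simp
  next
    case False
    then have "Suc A \<le> B" by simp
    then have "\<bar>(\<Sum>n\<in>{A<..B}. c n * w n) - T B * w B\<bar> \<le> K * (w (Suc A) - w B)"
    proof (induction B rule: dec_induct)
      case base
      have "{A<..Suc A} = {Suc A}" by auto
      then show ?case by (simp add: T_def)
    next
      case (step B)
      have split: "{A<..Suc B} = insert (Suc B) {A<..B}" using step.hyps by auto
      have "(\<Sum>n\<in>{A<..Suc B}. c n * w n) - T (Suc B) * w (Suc B)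
          = ((\<Sum>n\<in>{A<..B}. c n * w n) - T B * w B) + T B * (w B - w (Suc B))"
        by (simp add: split T_def algebra_simps)
      moreover have "\<bar>T B * (w B - w (Suc B))\<bar> \<le> K * (w B - w (Suc B))"
        using T[of B] dec[of B] step.hyps by (simp add: abs_mult mult_mono)
      ultimately show ?case using step.IH by (simp add: algebra_simps)
    qed
    moreover have "\<bar>T B * w B\<bar> \<le> K * w B"
      using T[of B] w0[of B] by (simp add: abs_mult mult_mono)
    ultimately show ?thesis by (simp add: algebra_simps)
  qed
qed

lemma sum_inverse_sqrt_le: "(\<Sum>n\<in>{1..N}. 1 / sqrt (real n)) \<le> 2 * sqrt (real N)"
proof (induction N)
  case 0
  then show ?case by simp
next
  case (Suc N)
  define x y where "x = sqrt (real N)" and "y = sqrt (real (Suc N))"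
  have xy: "0 \<le> x" "x \<le> y" "0 < y" "y\<^sup>2 = x\<^sup>2 + 1" by (auto simp: x_def y_def)
  have "1 = (y - x) * (y + x)" using xy(4) by (simp add: power2_eq_square algebra_simps)
  also have "\<dots> \<le> (y - x) * (2 * y)" using xy by (intro mult_left_mono) auto
  finally have "1 / y \<le> 2 * y - 2 * x" using xy by (simp add: field_simps)
  then show ?case using Suc by (simp add: x_def y_def)
qed

text \<open>
  The region under the hyperbola consists of the square \<open>d, e \<le> N\<close>, on which the sum is a product
  of two bounded sums, and of two mirror-image tails. In the tail \<open>d \<le> N < e\<close> the inner sum
  is of order \<open>1 / sqrt N\<close> by Abel summation, which just makes up for the \<open>2 * sqrt N\<close> that the
  absolute values of the outer weights contribute.
\<close>
lemma hyperbola_bound: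
  fixes f g :: "nat \<Rightarrow> real"
  assumes f1: "\<And>n. \<bar>f n\<bar> \<le> 1" and g1: "\<And>n. \<bar>g n\<bar> \<le> 1"
    and fK: "\<And>A B. \<bar>\<Sum>n\<in>{A<..B}. f n\<bar> \<le> K" and gK: "\<And>A B. \<bar>\<Sum>n\<in>{A<..B}. g n\<bar> \<le> K"
  shows "\<bar>\<Sum>(d, e) | 0 < d \<and> 0 < e \<and> d * e \<le> N\<^sup>2. f d * g e / sqrt (real (d * e))\<bar> \<le> K\<^sup>2 + 4 * K"
proof -
  have K0: "0 \<le> K" using fK[of 0 0] by simp
  define w :: "nat \<Rightarrow> real" where "w n = 1 / sqrt (real n)" for n
  have w0: "0 \<le> w n" for n by (simp add: w_def)
  have dec: "w (Suc n) \<le> w n" if "0 < n" for n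
    using that by (simp add: w_def frac_le)
  have tail: "\<bar>\<Sum>n\<in>{A<..B}. h n * w n\<bar> \<le> K * w (Suc A)"
    if "\<And>A B. \<bar>\<Sum>n\<in>{A<..B}. h n\<bar> \<le> K" for h A B
    by (rule Abel_inequality) (use that w0 dec in auto)
  \<comment> \<open>the contribution of one tail; \<open>h\<close> and \<open>k\<close> are \<open>f\<close> and \<open>g\<close> in either order\<close>
  have off: "\<bar>\<Sum>d\<in>{0<..N}. h d * w d * (\<Sum>e\<in>{N<..N\<^sup>2 div d}. k e * w e)\<bar> \<le> 2 * K"
    if h: "\<And>n. \<bar>h n\<bar> \<le> 1" and k: "\<And>A B. \<bar>\<Sum>n\<in>{A<..B}. k n\<bar> \<le> K" for h k
  proof -
    have "\<bar>\<Sum>d\<in>{0<..N}. h d * w d * (\<Sum>e\<in>{N<..N\<^sup>2 div d}. k e * w e)\<bar>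
        \<le> (\<Sum>d\<in>{0<..N}. \<bar>h d * w d * (\<Sum>e\<in>{N<..N\<^sup>2 div d}. k e * w e)\<bar>)"
      by (rule sum_abs)
    also have "\<dots> \<le> (\<Sum>d\<in>{0<..N}. w d * (K * w (Suc N)))"
    proof (rule sum_mono)
      fix d
      have "\<bar>h d * w d\<bar> \<le> w d"
        using mult_right_mono[OF h[of d] w0[of d]] w0[of d] by (simp add: abs_mult)
      then show "\<bar>h d * w d * (\<Sum>e\<in>{N<..N\<^sup>2 div d}. k e * w e)\<bar> \<le> w d * (K * w (Suc N))"
        unfolding abs_mult[of "h d * w d"] using tail[OF k] w0 by (intro mult_mono) auto
    qed
    also have "\<dots> = (\<Sum>d\<in>{1..N}. 1 / sqrt (real d)) * (K * w (Suc N))"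
      unfolding sum_distrib_right by (intro sum.cong) (auto simp: w_def)
    also have "\<dots> \<le> 2 * sqrt (real N) * (K * w (Suc N))"
      using sum_inverse_sqrt_le[of N] K0 w0 by (intro mult_right_mono) auto
    also have "\<dots> = 2 * K * (sqrt (real N) / sqrt (real (Suc N)))" by (simp add: w_def)
    also have "\<dots> \<le> 2 * K * 1" using K0 by (intro mult_left_mono) (auto simp: divide_le_eq)
    finally show ?thesis by simp
  qed
  define F where "F = (\<lambda>(d, e). f d * g e / sqrt (real (d * e)))"
  have F: "F (d, e) = (f d * w d) * (g e * w e)" for d e
    by (simp add: F_def w_def real_sqrt_mult)
  let ?S1 = "{0<..N} \<times> {0<..N}"
  let ?S2 = "SIGMA d:{0<..N}. {N<..N\<^sup>2 div d}"
  let ?S3 = "prod.swap ` ?S2"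
  have S: "{(d, e). 0 < d \<and> 0 < e \<and> d * e \<le> N\<^sup>2} = ?S1 \<union> (?S2 \<union> ?S3)" (is "?L = ?R")
  proof (rule Set.set_eqI)
    fix x :: "nat \<times> nat"
    obtain d e where x: "x = (d, e)" by (cases x)
    have sw: "(d, e) \<in> ?S3 \<longleftrightarrow> (e, d) \<in> ?S2"
      by (metis (no_types, lifting) imageE image_eqI prod.swap_def swap_swap swap_simp)
    have div: "e \<le> N\<^sup>2 div d \<longleftrightarrow> d * e \<le> N\<^sup>2" if "0 < d" for d e
      using that by (simp add: less_eq_div_iff_mult_less_eq mult.commute)
    have small: "d \<le> N \<or> e \<le> N" if "d * e \<le> N\<^sup>2"
    proof (rule ccontr)
      assume "\<not> ?thesis"
      then have "N * N < d * e" by (intro mult_strict_mono) auto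
      with that show False by (simp add: power2_eq_square)
    qed
    have big: "d * e \<le> N\<^sup>2" if "d \<le> N" "e \<le> N"
      using mult_le_mono[OF that] by (simp add: power2_eq_square)
    show "x \<in> ?L \<longleftrightarrow> x \<in> ?R"
      using div[of d e] div[of e d] small big unfolding x Un_iff sw
      by (auto simp: mult.commute)
  qed
  have "sum F ?L = sum F ?S1 + (sum F ?S2 + sum F ?S3)" unfolding S
    by (subst sum.union_disjoint; (subst sum.union_disjoint)?) auto
  moreover have "sum F ?S1 = (\<Sum>d\<in>{0<..N}. f d * w d) * (\<Sum>e\<in>{0<..N}. g e * w e)"
    by (simp add: sum_product sum.cartesian_product F_def case_prod_unfold w_def real_sqrt_mult)
  moreover have "\<bar>\<dots>\<bar> \<le> K * K"
    unfolding abs_mult using tail[OF fK, of 0 N] tail[OF gK, of 0 N] K0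
    by (intro mult_mono) (auto simp: w_def)
  moreover have "sum F ?S2 = (\<Sum>d\<in>{0<..N}. f d * w d * (\<Sum>e\<in>{N<..N\<^sup>2 div d}. g e * w e))"
    by (simp add: F_def w_def real_sqrt_mult sum_distrib_left sum.Sigma)
  moreover have "sum F ?S3 = (\<Sum>d\<in>{0<..N}. g d * w d * (\<Sum>e\<in>{N<..N\<^sup>2 div d}. f e * w e))"
  proof -
    have "sum F ?S3 = sum (F \<circ> prod.swap) ?S2" by (rule sum.reindex) auto
    also have "\<dots> = (\<Sum>(d, e)\<in>?S2. (g d * w d) * (f e * w e))"
      by (intro sum.cong) (auto simp: F)
    finally show ?thesis by (simp add: sum_distrib_left sum.Sigma)
  qed
  ultimately have "\<bar>sum F ?L\<bar> \<le> K\<^sup>2 + 4 * K"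
    using off[of f g, OF f1 gK] off[of g f, OF g1 fK]
    unfolding power2_eq_square[of K] by linarith
  then show ?thesis by (simp add: F_def)
qed

definition divisor_conv :: "(nat \<Rightarrow> real) \<Rightarrow> (nat \<Rightarrow> real) \<Rightarrow> nat \<Rightarrow> real" where
  "divisor_conv f g n = (\<Sum>d | d dvd n. f d * g (n div d))"

lemma sum_hyperbola_eq_sum_conv:
  "(\<Sum>(d, e) | 0 < d \<and> 0 < e \<and> d * e \<le> X. f d * g e / sqrt (real (d * e)))
    = (\<Sum>n\<in>{0<..X}. divisor_conv f g n / sqrt (real n))"
proof -
  let ?S = "SIGMA n:{0<..X}. {d. d dvd n}"
  have "(\<Sum>n\<in>{0<..X}. divisor_conv f g n / sqrt (real n))
      = (\<Sum>n\<in>{0<..X}. \<Sum>d | d dvd n. f d * g (n div d) / sqrt (real n))"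
    by (simp add: divisor_conv_def sum_divide_distrib)
  also have "\<dots> = (\<Sum>(n, d)\<in>?S. f d * g (n div d) / sqrt (real n))"
    by (subst sum.Sigma) auto
  also have "\<dots> = (\<Sum>(d, e) | 0 < d \<and> 0 < e \<and> d * e \<le> X. f d * g e / sqrt (real (d * e)))"
    by (rule sum.reindex_bij_witness[where i = "\<lambda>(d, e). (d * e, d)" and j = "\<lambda>(n, d). (d, n div d)"])
       (auto elim!: dvdE)
  finally show ?thesis by simp
qed

text \<open>
  Every divisor of \<open>m * n\<close> is uniquely a product of a divisor of \<open>m\<close> and a divisor of \<open>n\<close>.
\<close>
lemma divisor_conv_mult_coprime:
  assumes f: "\<And>m n. f (m * n) = f m * f n" and g: "\<And>m n. g (m * n) = g m * g n"
    and "coprime m n" "0 < m" "0 < n"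
  shows "divisor_conv f g (m * n) = divisor_conv f g m * divisor_conv f g n"
proof -
  have div: "m * n div (a * b) = (m div a) * (n div b)" if "a dvd m" "b dvd n" for a b
    using that assms(4,5) by (auto elim!: dvdE)
  have inj: "inj_on (\<lambda>(a, b). a * b) ({a. a dvd m} \<times> {b. b dvd n})"
  proof (rule inj_on_inverseI[where g = "\<lambda>d. (gcd d m, gcd d n)"], clarsimp)
    fix a b assume ab: "a dvd m" "b dvd n"
    have "coprime b m" "coprime a n"
      using ab assms(3) by (meson coprime_commute coprime_divisors dvd_refl)+
    then have "gcd (a * b) m = gcd a m" "gcd (a * b) n = gcd b n"
      by (simp_all add: gcd_mult_left_right_cancel gcd_mult_left_left_cancel coprime_commute)
    then show "gcd (a * b) m = a \<and> gcd (a * b) n = b"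
      using ab by (simp add: gcd_nat.absorb1)
  qed
  have im: "{d. d dvd m * n} = (\<lambda>(a, b). a * b) ` ({a. a dvd m} \<times> {b. b dvd n})"
  proof (intro equalityI subsetI)
    fix d assume "d \<in> {d. d dvd m * n}"
    then obtain a b where "d = a * b" "a dvd m" "b dvd n"
      using division_decomp[of d m n] by blast
    then show "d \<in> (\<lambda>(a, b). a * b) ` ({a. a dvd m} \<times> {b. b dvd n})" by auto
  qed (auto intro: mult_dvd_mono)
  have "divisor_conv f g (m * n)
      = (\<Sum>(a, b)\<in>{a. a dvd m} \<times> {b. b dvd n}. f (a * b) * g (m * n div (a * b)))"
    unfolding divisor_conv_def im by (subst sum.reindex[OF inj]) (simp add: case_prod_unfold)
  also have "\<dots> = (\<Sum>(a, b)\<in>{a. a dvd m} \<times> {b. b dvd n}. (f a * g (m div a)) * (f b * g (n div b)))"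
    by (intro sum.cong) (auto simp: div f g)
  also have "\<dots> = divisor_conv f g m * divisor_conv f g n"
    by (simp add: divisor_conv_def sum_product sum.cartesian_product)
  finally show ?thesis .
qed

section \<open>Quadratic characters\<close>

text \<open>
  Real-valued nonprincipal Dirichlet characters modulo \<open>M\<close>; since their only values are \<open>-1\<close>, \<open>0\<close>
  and \<open>1\<close>, being nonprincipal means taking the value \<open>-1\<close>.
\<close>
locale quadratic_character =
  fixes M :: nat and f :: "nat \<Rightarrow> real"
  assumes mod_pos: "0 < M"
    and mult: "f (m * n) = f m * f n"
    and vals: "f n \<in> {-1, 0, 1}"
    and zero_iff: "f n = 0 \<longleftrightarrow> \<not> coprime n M"
    and periodic: "f (n + M) = f n"
    and nonprincipal: "\<exists>n. f n = -1"
begin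

lemma one [simp]: "f 1 = 1"
  using mult[of 1 1] zero_iff[of 1] by auto

lemma one' [simp]: "f (Suc 0) = 1"
  using one by simp

lemma power: "f (n ^ k) = f n ^ k"
  by (induction k) (simp_all add: mult)

lemma abs_le_1: "\<bar>f n\<bar> \<le> 1"
  using vals[of n] by auto

lemma mod_eq: "f (n mod M) = f n"
proof -
  have "f (r + q * M) = f r" for r q
    by (induction q) (simp_all add: periodic add.assoc[symmetric] add.commute[of M])
  from this[of "n mod M" "n div M"] show ?thesis by simp
qed

text \<open>
  Multiplication by some \<open>c\<close> with \<open>f c = -1\<close> permutes the residues and reverses the sign of the sum.
\<close>
lemma sum_period_eq_0: "(\<Sum>n<M. f n) = 0"
proof -
  obtain c where c: "f c = -1" using nonprincipal by blast
  then have cop: "coprime c M" using zero_iff[of c] by auto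
  have inj: "inj_on (\<lambda>n. (c * n) mod M) {..<M}"
  proof (rule inj_onI)
    fix x y assume "x \<in> {..<M}" "y \<in> {..<M}" "c * x mod M = c * y mod M"
    then have "[c * x = c * y] (mod M)" by (simp add: cong_def)
    then have "[x = y] (mod M)" using cop by (simp add: cong_mult_lcancel_nat)
    with \<open>x \<in> _\<close> \<open>y \<in> _\<close> show "x = y" by (simp add: cong_def)
  qed
  have "(\<lambda>n. (c * n) mod M) ` {..<M} = {..<M}"
    by (rule endo_inj_surj[OF _ _ inj]) (use mod_pos in auto)
  then have "(\<Sum>n<M. f n) = (\<Sum>n<M. f (c * n mod M))"
    using sum.reindex[OF inj, of f] by simp
  also have "\<dots> = - (\<Sum>n<M. f n)" by (simp add: mod_eq mult c sum_negf)
  finally show ?thesis by simp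
qed

lemma interval_sum_bound: "\<bar>\<Sum>n\<in>{A<..B}. f n\<bar> \<le> 2 * real M"
proof -
  have init: "\<bar>\<Sum>n<k. f n\<bar> \<le> real M" for k
  proof (induction k rule: less_induct)
    case (less k)
    show ?case
    proof (cases "k < M")
      case True
      have "\<bar>\<Sum>n<k. f n\<bar> \<le> (\<Sum>n<k. 1)"
        by (rule order_trans[OF sum_abs sum_mono]) (rule abs_le_1)
      then show ?thesis using True by simp
    next
      case False
      then have k: "{..<k} = {..<M} \<union> {M..<M + (k - M)}" by auto
      have "(\<Sum>n<k. f n) = (\<Sum>n<M. f n) + (\<Sum>n\<in>{M..<M + (k - M)}. f n)"
        unfolding k by (subst sum.union_disjoint) auto
      also have "(\<Sum>n\<in>{M..<M + (k - M)}. f n) = (\<Sum>n<k - M. f n)"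
        using sum.shift_bounds_nat_ivl[of f 0 M "k - M"]
        by (simp add: add.commute periodic atLeast0LessThan)
      finally show ?thesis using sum_period_eq_0 less.IH[of "k - M"] False mod_pos by simp
    qed
  qed
  show ?thesis
  proof (cases "A \<le> B")
    case True
    then have "{..<Suc B} = {..<Suc A} \<union> {A<..B}" by auto
    moreover have "{..<Suc A} \<inter> {A<..B} = {}" by auto
    ultimately have "(\<Sum>n<Suc B. f n) = (\<Sum>n<Suc A. f n) + (\<Sum>n\<in>{A<..B}. f n)"
      by (metis finite_greaterThanAtMost finite_lessThan sum.union_disjoint)
    then show ?thesis using init[of "Suc A"] init[of "Suc B"] by linarith
  qed auto
qed

end

text \<open>
  With \<open>x = f p\<close> and \<open>y = g p\<close> the value at \<open>p ^ k\<close> is the sum of \<open>x ^ i * y ^ (k - i)\<close> over \<open>i \<le> k\<close>: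
  this is \<open>k + 1\<close> if \<open>x = y = 1\<close>, and an alternating sum, \<open>1\<close> or \<open>0\<close> according to the parity of \<open>k\<close>,
  if exactly one of them is \<open>-1\<close>. Only \<open>x = y = -1\<close> can make it negative.
\<close>
lemma divisor_conv_prime_power:
  assumes f: "quadratic_character M f" and g: "quadratic_character M g" and p: "prime p"
    and pos: "f p = 1 \<or> g p = 1 \<or> f p = 0"
  shows "0 \<le> divisor_conv f g (p ^ k)"
    and "even k \<Longrightarrow> f p \<noteq> 0 \<Longrightarrow> 1 \<le> divisor_conv f g (p ^ k)"
proof -
  interpret f: quadratic_character M f by fact
  interpret g: quadratic_character M g by fact
  have inj: "inj_on (\<lambda>i. p ^ i) {..k}"
    using prime_gt_1_nat[OF p] by (auto intro!: inj_onI)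
  have "{d. d dvd p ^ k} = (\<lambda>i. p ^ i) ` {..k}"
    using p by (auto simp: divides_primepow_nat le_imp_power_dvd)
  then have "divisor_conv f g (p ^ k) = (\<Sum>i\<le>k. f (p ^ i) * g (p ^ k div p ^ i))"
    by (simp add: divisor_conv_def sum.reindex[OF inj])
  also have "\<dots> = (\<Sum>i\<le>k. f p ^ i * g p ^ (k - i))"
    using prime_gt_0_nat[OF p] by (intro sum.cong) (simp_all add: f.power flip: g.power power_diff)
  finally have *: "divisor_conv f g (p ^ k) = (\<Sum>i\<le>k. f p ^ i * g p ^ (k - i))" .
  have alt: "(\<Sum>i\<le>k. (-1::real) ^ i) = (if even k then 1 else 0)" for k
    by (induction k) auto
  have alt': "(\<Sum>i\<le>k. (-1::real) ^ (k - i)) = (if even k then 1 else 0)"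
    using sum.nat_diff_reindex[of "\<lambda>i. (-1::real) ^ i" "Suc k"] by (simp add: lessThan_Suc_atMost alt)
  have zero: "f p = 0 \<longleftrightarrow> g p = 0" by (simp add: f.zero_iff g.zero_iff)
  consider "f p = 0" "g p = 0" | "f p = 1" "g p = 1" | "f p = 1" "g p = -1" | "f p = -1" "g p = 1"
    using pos zero f.vals[of p] g.vals[of p] by auto
  then have "0 \<le> divisor_conv f g (p ^ k) \<and> (even k \<longrightarrow> f p \<noteq> 0 \<longrightarrow> 1 \<le> divisor_conv f g (p ^ k))"
  proof cases
    case 1
    then show ?thesis unfolding * by (auto intro!: sum_nonneg)
  qed (auto simp: * alt alt')
  then show "0 \<le> divisor_conv f g (p ^ k)"
    and "even k \<Longrightarrow> f p \<noteq> 0 \<Longrightarrow> 1 \<le> divisor_conv f g (p ^ k)" by blast+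
qed

lemma divisor_conv_nonneg:
  assumes f: "quadratic_character M f" and g: "quadratic_character M g"
    and pos: "\<And>p. prime p \<Longrightarrow> f p \<noteq> -1 \<or> g p \<noteq> -1" and "0 < n"
  shows "0 \<le> divisor_conv f g n \<and> (is_square n \<and> coprime n M \<longrightarrow> 1 \<le> divisor_conv f g n)"
  using \<open>0 < n\<close>
proof (induction n rule: less_induct)
  case (less n)
  interpret f: quadratic_character M f by fact
  interpret g: quadratic_character M g by fact
  show ?case
  proof (cases "n = 1")
    case True
    have "{d. d dvd (1::nat)} = {1}" by auto
    then show ?thesis using True by (simp add: divisor_conv_def)
  next
    case False
    then obtain p where p: "prime p" "p dvd n" using prime_factor_nat by blast
    define k where "k = multiplicity p n"
    obtain m where n: "n = p ^ k * m" "\<not> p dvd m"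
      using multiplicity_decompose'[of n p] less.prems p unfolding k_def by (metis not_prime_unit not_gr_zero)
    have k0: "0 < k" using p less.prems by (simp add: k_def prime_multiplicity_gt_zero_iff)
    have m0: "0 < m" using n less.prems by (cases m) auto
    have "1 < p ^ k" using k0 prime_gt_1_nat[OF p(1)] by (intro one_less_power)
    then have "m < n" using n(1) m0 by simp
    have cop: "coprime (p ^ k) m"
      using p(1) n(2) k0 by (simp add: prime_imp_coprime)
    have prod: "divisor_conv f g n = divisor_conv f g (p ^ k) * divisor_conv f g m"
      unfolding n(1) using cop m0 prime_gt_0_nat[OF p(1)]
      by (intro divisor_conv_mult_coprime f.mult g.mult) auto
    have pos': "f p = 1 \<or> g p = 1 \<or> f p = 0"
      using pos[OF p(1)] f.vals[of p] g.vals[of p] g.zero_iff[of p] f.zero_iff[of p] by auto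
    note pk = divisor_conv_prime_power[OF f g p(1) pos', of k]
    note m = less.IH[OF \<open>m < n\<close> m0]
    show ?thesis
    proof (intro conjI impI)
      show "0 \<le> divisor_conv f g n" using pk(1) m by (simp add: prod)
      assume sq: "is_square n \<and> coprime n M"
      have "is_square (p ^ k)" "is_square m"
        using sq cop unfolding n(1) by (simp_all add: is_nth_power_mult_coprime_nat_iff)
      then have "even k" using p(1) is_nth_power_prime_power_nat_iff[of p 2 k] by simp
      moreover have "f p \<noteq> 0" "coprime m M"
        using sq k0 unfolding n(1) by (simp_all add: f.zero_iff)
      ultimately have "1 \<le> divisor_conv f g (p ^ k)" "1 \<le> divisor_conv f g m"
        using pk(2) m \<open>is_square m\<close> by auto
      then show "1 \<le> divisor_conv f g n"
        unfolding prod using mult_mono[of 1 "divisor_conv f g (p ^ k)" 1 "divisor_conv f g m"] by simp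
    qed
  qed
qed

text \<open>
  The weights \<open>1 / sqrt n\<close> are chosen at the critical exponent: there the squares alone already
  make the sum diverge, while the hyperbola method still gives a bounded sum, since both characters
  are nonprincipal.
\<close>
lemma common_prime_value_minus_one:
  assumes f: "quadratic_character M f" and g: "quadratic_character M g"
  obtains p where "prime p" "f p = -1" "g p = -1"
proof (rule ccontr)
  assume "\<not> thesis"
  with that have pos: "\<And>p. prime p \<Longrightarrow> f p \<noteq> -1 \<or> g p \<noteq> -1" by blast
  interpret f: quadratic_character M f by fact
  interpret g: quadratic_character M g by fact
  define K where "K = 2 * real M"
  note r = divisor_conv_nonneg[OF f g pos]
  have bound: "harm J \<le> real M * (K\<^sup>2 + 4 * K)" for J :: nat
  proof -
    define N where "N = J * M"
    \<comment> \<open>only the squares of the numbers \<open>j * M + 1\<close>, which are prime to \<open>M\<close>, are kept\<close>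
    let ?h = "\<lambda>n. divisor_conv f g n / sqrt (real n)"
    let ?q = "\<lambda>j. (j * M + 1)\<^sup>2"
    have inj: "inj_on ?q {..<J}" using f.mod_pos by (auto intro!: inj_onI simp: power2_eq_iff_nonneg)
    have le: "?q j \<le> N\<^sup>2" if "j < J" for j
    proof -
      have "j * M + 1 \<le> Suc j * M" using f.mod_pos by simp
      also have "\<dots> \<le> J * M" using that by (intro mult_right_mono) auto
      finally show ?thesis unfolding N_def by (rule power_mono) auto
    qed
    have "harm J / real M = (\<Sum>j<J. inverse (real (Suc j) * real M))"
      by (simp add: harm_altdef sum_distrib_right divide_inverse)
    also have "\<dots> \<le> (\<Sum>j<J. ?h (?q j))"
    proof (rule sum_mono)
      fix j
      have "coprime (j * M + 1) M" by (metis coprime_1_left coprime_iff_gcd_eq_1 gcd_add_mult mult.commute add.commute gcd.commute)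
      then have "1 \<le> divisor_conv f g (?q j)" using r[of "?q j"] by simp
      then have "1 / real (j * M + 1) \<le> ?h (?q j)"
        unfolding of_nat_power by (simp add: divide_right_mono)
      moreover have "inverse (real (Suc j) * real M) \<le> 1 / real (j * M + 1)"
        unfolding inverse_eq_divide using f.mod_pos
        by (intro frac_le) (simp_all add: algebra_simps add_pos_nonneg)
      ultimately show "inverse (real (Suc j) * real M) \<le> ?h (?q j)" by linarith
    qed
    also have "\<dots> = sum ?h (?q ` {..<J})" unfolding sum.reindex[OF inj] o_def ..
    also have "\<dots> \<le> sum ?h {0<..N\<^sup>2}"
      by (rule sum_mono2) (use le r in \<open>auto intro!: divide_nonneg_nonneg\<close>)
    also have "\<dots> \<le> K\<^sup>2 + 4 * K"
      using hyperbola_bound[of f g K N] f.abs_le_1 g.abs_le_1 f.interval_sum_bound g.interval_sum_bound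
      unfolding sum_hyperbola_eq_sum_conv K_def by (meson abs_le_D1)
    finally show ?thesis using f.mod_pos by (simp add: field_simps)
  qed
  have "eventually (\<lambda>J. harm J > real M * (K\<^sup>2 + 4 * K)) sequentially"
    using harm_at_top by (auto simp: filterlim_at_top_dense)
  with bound show False by (metis eventually_sequentially linorder_not_less order_refl)
qed

section \<open>The Jacobi symbol\<close>

lemma Legendre_vals: "Legendre a p \<in> {-1, 0, 1}"
  by (simp add: Legendre_def)

lemma Legendre_eq_0_iff: "Legendre a p = 0 \<longleftrightarrow> p dvd a"
  by (simp add: Legendre_def cong_0_iff)

lemma Legendre_cong:
  assumes "[a = b] (mod p)"
  shows "Legendre a p = Legendre b p"
proof -
  have "[x = a] (mod p) \<longleftrightarrow> [x = b] (mod p)" for x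
    using assms by (meson cong_sym cong_trans)
  moreover have "[a = 0] (mod p) \<longleftrightarrow> [b = 0] (mod p)"
    using assms by (meson cong_sym cong_trans)
  ultimately show ?thesis by (simp add: Legendre_def QuadRes_def)
qed

lemma Legendre_one [simp]:
  assumes "prime p" shows "Legendre 1 (int p) = 1"
proof -
  have "\<not> int p dvd 1" using assms by (auto simp: prime_nat_iff)
  moreover have "QuadRes (int p) 1" unfolding QuadRes_def by (rule exI[of _ 1]) simp
  ultimately show ?thesis by (simp add: Legendre_def cong_0_iff)
qed

lemma eq_if_cong_mod_prime:
  assumes "prime p" "2 < p" "[x = y] (mod int p)" "x \<in> {-1, 0, 1}" "y \<in> {-1, 0, 1}"
  shows "x = y"
proof -
  have "int p dvd x - y" using assms(3) by (simp add: cong_iff_dvd_diff)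
  moreover have "\<bar>x - y\<bar> < int p" using assms by auto
  ultimately show ?thesis using zdvd_not_zless[of "\<bar>x - y\<bar>" "int p"] by auto
qed

lemma Legendre_mult:
  assumes "prime p" "2 < p"
  shows "Legendre (a * b) (int p) = Legendre a (int p) * Legendre b (int p)"
proof (rule eq_if_cong_mod_prime[OF assms])
  have "[a ^ ((p - 1) div 2) * b ^ ((p - 1) div 2) = Legendre a (int p) * Legendre b (int p)] (mod int p)"
    by (intro cong_mult cong_sym[OF euler_criterion[OF assms]])
  then show "[Legendre (a * b) (int p) = Legendre a (int p) * Legendre b (int p)] (mod int p)"
    using euler_criterion[OF assms, of "a * b"] by (metis cong_trans power_mult_distrib)
qed (use Legendre_vals[of a p] Legendre_vals[of b p] Legendre_vals[of "a * b" p] in auto)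

text \<open>
  Squaring identifies \<open>1\<close> and \<open>q - 1\<close>, hence is not surjective on the finite set of residues.
\<close>
lemma nonresidue_exists:
  assumes "prime q" "2 < q"
  obtains z :: nat where "Legendre (int z) (int q) = -1"
proof -
  let ?s = "\<lambda>x. x\<^sup>2 mod q"
  have "?s 1 = ?s (q - 1)"
  proof -
    have "int ((q - 1)\<^sup>2) = int q * (int q - 2) + 1"
      using assms by (cases q) (simp_all add: power2_eq_square algebra_simps)
    then have "[int ((q - 1)\<^sup>2) = int 1] (mod int q)" by (simp add: cong_iff_dvd_diff)
    then have "[(q - 1)\<^sup>2 = 1] (mod q)" by (simp only: cong_int_iff)
    then show ?thesis by (simp add: cong_def)
  qed
  moreover have "1 \<in> {..<q}" "q - 1 \<in> {..<q}" "1 \<noteq> q - 1" using assms by auto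
  ultimately have "\<not> inj_on ?s {..<q}" by (meson inj_onD)
  then have "?s ` {..<q} \<noteq> {..<q}"
    using eq_card_imp_inj_on[of "{..<q}" ?s] by auto
  moreover have "?s ` {..<q} \<subseteq> {..<q}" using assms by auto
  ultimately obtain z where z: "z < q" "z \<notin> ?s ` {..<q}" by blast
  have "\<not> int q dvd int z"
  proof
    assume "int q dvd int z"
    then have "z = 0" using z(1) by (auto dest: dvd_imp_le)
    moreover have "?s 0 \<in> ?s ` {..<q}" using assms by (intro imageI) simp
    ultimately show False using z(2) by simp
  qed
  moreover have "\<not> QuadRes (int q) (int z)"
  proof
    assume "QuadRes (int q) (int z)"
    then obtain y where y: "[y\<^sup>2 = int z] (mod int q)" by (auto simp: QuadRes_def)
    define x where "x = nat (y mod int q)"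
    have x: "int x = y mod int q" "x < q" using assms by (auto simp: x_def nat_less_iff)
    have "int (?s x) = int z mod int q"
      using y by (simp add: of_nat_mod x power_mod cong_def)
    then have "?s x = z" using z(1) by (metis of_nat_eq_iff of_nat_mod mod_less)
    then show False using z x by auto
  qed
  ultimately have "Legendre (int z) (int q) = -1" by (simp add: Legendre_def cong_0_iff)
  then show thesis by (rule that)
qed

definition Jacobi :: "nat \<Rightarrow> nat \<Rightarrow> int" where
  "Jacobi n a = (\<Prod>q\<in>#prime_factorization a. Legendre (int n) (int q))"

lemma Jacobi_one_right [simp]: "Jacobi n (Suc 0) = 1"
  by (simp add: Jacobi_def)

lemma Jacobi_mult_right: "0 < a \<Longrightarrow> 0 < b \<Longrightarrow> Jacobi n (a * b) = Jacobi n a * Jacobi n b"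
  by (simp add: Jacobi_def prime_factorization_mult)

lemma Jacobi_prime_right: "prime q \<Longrightarrow> Jacobi n q = Legendre (int n) (int q)"
  by (simp add: Jacobi_def prime_factorization_prime)

lemma Jacobi_prime_power_right: "prime q \<Longrightarrow> Jacobi n (q ^ k) = Legendre (int n) (int q) ^ k"
  by (simp add: Jacobi_def prime_factorization_prime_power)

lemma odd_prime_factor:
  assumes "odd a" "q \<in># prime_factorization (a::nat)"
  shows "prime q" "2 < q"
proof -
  show q: "prime q" using assms(2) by (rule in_prime_factors_imp_prime)
  have "q dvd a" using assms(2) by (rule in_prime_factors_imp_dvd)
  then have "q \<noteq> 2" using assms(1) by auto
  then show "2 < q" using prime_ge_2_nat[OF q] by simp
qed

lemma Jacobi_mult_left: "odd a \<Longrightarrow> Jacobi (m * n) a = Jacobi m a * Jacobi n a"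
  unfolding Jacobi_def prod_mset.distrib[symmetric]
  by (intro arg_cong[of _ _ prod_mset] image_mset_cong) (simp add: Legendre_mult odd_prime_factor)

lemma Jacobi_one_left [simp]: "Jacobi (Suc 0) a = 1"
proof -
  have "Jacobi (Suc 0) a = (\<Prod>q\<in>#prime_factorization a. 1)"
    unfolding Jacobi_def
    by (intro arg_cong[of _ _ prod_mset] image_mset_cong) (auto dest: in_prime_factors_imp_prime)
  then show ?thesis by simp
qed

lemma Jacobi_cong:
  assumes "[m = n] (mod a)" shows "Jacobi m a = Jacobi n a"
proof -
  have "Legendre (int m) (int q) = Legendre (int n) (int q)" if "q \<in># prime_factorization a" for q
    using assms in_prime_factors_imp_dvd[OF that]
    by (intro Legendre_cong) (auto simp: cong_int_iff intro: cong_dvd_modulus_nat)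
  then show ?thesis unfolding Jacobi_def by (intro arg_cong[of _ _ prod_mset] image_mset_cong)
qed

lemma Jacobi_vals: "Jacobi n a \<in> {-1, 0, 1}"
proof -
  have "(\<Prod>q\<in>#A. Legendre (int n) (int q)) \<in> {-1, 0, 1}" for A :: "nat multiset"
  proof (induction A)
    case (add q A)
    then show ?case using Legendre_vals[of "int n" "int q"] by auto
  qed simp
  then show ?thesis by (simp add: Jacobi_def)
qed

lemma Jacobi_eq_0_iff:
  assumes "0 < a" shows "Jacobi n a = 0 \<longleftrightarrow> \<not> coprime n a"
proof -
  have "Jacobi n a = 0 \<longleftrightarrow> (\<exists>q. prime q \<and> q dvd a \<and> q dvd n)"
    using assms by (auto simp: Jacobi_def Legendre_eq_0_iff prime_factors_dvd)
  also have "\<dots> \<longleftrightarrow> \<not> coprime n a"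
  proof
    assume "\<exists>q. prime q \<and> q dvd a \<and> q dvd n"
    then show "\<not> coprime n a" using coprime_common_divisor_nat not_prime_1 by blast
  next
    assume "\<not> coprime n a"
    then have "gcd n a \<noteq> 1" using coprime_iff_gcd_eq_1 by blast
    then obtain q where "prime q" "q dvd gcd n a" using prime_factor_nat by blast
    then show "\<exists>q. prime q \<and> q dvd a \<and> q dvd n" by auto
  qed
  finally show ?thesis .
qed

text \<open>
  Some prime \<open>q\<close> divides \<open>a\<close> to an odd power \<open>q ^ k\<close>. By the Chinese remainder theorem there is an \<open>n\<close>
  which is a non-residue modulo \<open>q\<close> and \<open>1\<close> modulo the cofactor of \<open>q ^ k\<close> (and modulo \<open>2\<close>).
\<close>
lemma Jacobi_nontrivial:
  assumes "odd a" "\<not> is_square a"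
  obtains n where "odd n" "Jacobi n a = -1"
proof -
  have a0: "0 < a" using assms(1) by (rule odd_pos)
  obtain q where q: "prime q" "odd (multiplicity q a)"
    using assms(2) by (auto simp: is_nth_power_conv_multiplicity_nat)
  then have "multiplicity q a \<noteq> 0" by presburger
  then have "q \<in># prime_factorization a" using q a0 by (simp add: prime_factors_multiplicity)
  then have q2: "2 < q" using assms(1) odd_prime_factor by blast
  define k where "k = multiplicity q a"
  have "odd k" using q(2) by (simp add: k_def)
  obtain b where b: "a = q ^ k * b" "\<not> q dvd b"
    using multiplicity_decompose'[of a q] a0 q unfolding k_def
    by (metis not_gr_zero not_prime_unit)
  obtain z where z: "Legendre (int z) (int q) = -1" using nonresidue_exists[OF q(1) q2] .
  have "coprime q (2 * b)"
    using q(1) q2 b(2) primes_dvd_imp_eq[OF q(1) two_is_prime_nat]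
    by (intro prime_imp_coprime) (auto simp: prime_dvd_mult_iff)
  then obtain n where n: "[n = z] (mod q)" "[n = 1] (mod (2 * b))"
    using binary_chinese_remainder_nat by blast
  have "odd n" using cong_dvd_modulus_nat[OF n(2), of 2] by (simp add: cong_def odd_iff_mod_2_eq_one)
  moreover have "Jacobi n a = -1"
  proof -
    have "Jacobi n b = 1" using Jacobi_cong[of n 1 b] cong_dvd_modulus_nat[OF n(2), of b] by simp
    moreover have "Legendre (int n) (int q) = -1"
      using z Legendre_cong[of "int n" "int z" "int q"] n(1) by (simp add: cong_int_iff)
    moreover have "0 < b" using b a0 by (cases b) auto
    ultimately show ?thesis
      using q(1) prime_gt_0_nat[OF q(1)] \<open>odd k\<close> unfolding b(1)
      by (simp add: Jacobi_mult_right Jacobi_prime_power_right)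
  qed
  ultimately show thesis by (rule that)
qed

text \<open>
  The reciprocity law for the primes \<open>q\<close> dividing \<open>a\<close>; as \<open>(p - 1) / 2\<close> is odd, each contributes the sign
  \<open>1\<close> or \<open>-1\<close> according to \<open>q\<close> modulo \<open>4\<close>, and these signs are multiplicative.
\<close>
lemma Jacobi_reciprocity:
  assumes p: "prime p" "p mod 4 = 3" and "odd a" "coprime p a"
  shows "Legendre (int a) (int p) = (if a mod 4 = 1 then 1 else -1) * Jacobi p a"
  using assms(3,4)
proof (induction a rule: prime_divisors_induct)
  case (unit a)
  then show ?case using p by simp
next
  case (factor q b)
  have p2: "2 < p" using p prime_ge_2_nat[OF p(1)] by (cases "p = 2") auto
  have q: "odd q" "odd b" "coprime p q" "coprime p b" using factor.prems by auto
  then have q2: "2 < q" using prime_ge_2_nat[OF factor.hyps(1)] by (cases "q = 2") auto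
  have b0: "0 < b" using q by (simp add: odd_pos)
  have "p \<noteq> q" using q(3) p(1) by auto
  note QR = Quadratic_Reciprocity[OF p(1) p2 factor.hyps(1) q2 this]
  have "odd ((p - 1) div 2)" using p(2) by presburger
  moreover have "even ((q - 1) div 2) \<longleftrightarrow> q mod 4 = 1" using q(1) by presburger
  ultimately have "Legendre (int p) (int q) * Legendre (int q) (int p) = (if q mod 4 = 1 then 1 else -1)"
    using QR by simp
  moreover have "Legendre (int q) (int p) * Legendre (int q) (int p) = 1"
  proof -
    have "\<not> int p dvd int q" using \<open>p \<noteq> q\<close> p(1) factor.hyps(1) by (metis int_dvd_int_iff primes_dvd_imp_eq)
    then show ?thesis using Legendre_vals[of q p] Legendre_eq_0_iff[of q p] by auto
  qed
  ultimately have 1: "Legendre (int q) (int p) = (if q mod 4 = 1 then 1 else -1) * Legendre (int p) (int q)"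
    using Legendre_vals[of p q] Legendre_vals[of q p] by (auto split: if_splits)
  have 2: "(q * b) mod 4 = 1 \<longleftrightarrow> (q mod 4 = 1 \<longleftrightarrow> b mod 4 = 1)"
  proof -
    have "q mod 4 = 1 \<or> q mod 4 = 3" "b mod 4 = 1 \<or> b mod 4 = 3" using q by presburger+
    then show ?thesis by (auto simp: mod_mult_eq[of q 4 b, symmetric])
  qed
  have 3: "Jacobi p (q * b) = Legendre (int p) (int q) * Jacobi p b"
    using b0 factor.hyps(1) prime_gt_0_nat[OF factor.hyps(1)]
    by (simp add: Jacobi_mult_right Jacobi_prime_right)
  have IH: "Legendre (int b) (int p) = (if b mod 4 = 1 then 1 else -1) * Jacobi p b"
    using factor.IH q by simp
  show ?case
    unfolding of_nat_mult Legendre_mult[OF p(1) p2] 1 2 3 IH by auto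
qed (simp)

section \<open>Primes congruent to 3 modulo 4 and sums of two squares\<close>

lemma prime_3_mod_4_factor:
  assumes "(n::nat) mod 4 = 3"
  obtains p where "prime p" "p dvd n" "p mod 4 = 3"
proof (rule ccontr)
  assume "\<not> thesis"
  with that have no: "\<And>p. prime p \<Longrightarrow> p dvd n \<Longrightarrow> p mod 4 \<noteq> 3" by blast
  have "odd n \<Longrightarrow> (\<forall>p. prime p \<longrightarrow> p dvd n \<longrightarrow> p mod 4 \<noteq> 3) \<Longrightarrow> n mod 4 = 1" for n :: nat
  proof (induction n rule: prime_divisors_induct)
    case (factor p m)
    then have "odd p" "p mod 4 \<noteq> 3" "m mod 4 = 1" by auto
    moreover from this have "p mod 4 = 1" by presburger
    ultimately show ?case by (simp add: mod_mult_eq[of p 4 m, symmetric])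
  qed auto
  moreover have "odd n" using assms by presburger
  ultimately show False using no assms by auto
qed

text \<open>
  Otherwise the square \<open>s\<^sup>2\<close> would be congruent to \<open>- t\<^sup>2\<close>, whose Legendre symbol is \<open>-1\<close> or \<open>0\<close>.
\<close>
lemma prime_dvd_sum_squares:
  assumes p: "prime p" "p mod 4 = 3" and dvd: "int p dvd s\<^sup>2 + t\<^sup>2"
  shows "int p dvd s"
proof (rule ccontr)
  assume s: "\<not> int p dvd s"
  have p2: "2 < p" using p prime_ge_2_nat[OF p(1)] by (cases "p = 2") auto
  have odd: "odd ((p - 1) div 2)" using p(2) by presburger
  have "[Legendre (-1) (int p) = -1] (mod int p)"
    using euler_criterion[OF p(1) p2, of "-1"] odd by simp
  then have m1: "Legendre (-1) (int p) = -1"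
    by (rule eq_if_cong_mod_prime[OF p(1) p2]) (use Legendre_vals[of "-1" p] in auto)
  have sq: "Legendre (x\<^sup>2) (int p) = 1" if "\<not> int p dvd x" for x
    using that Legendre_vals[of x p] Legendre_eq_0_iff[of x p]
    by (auto simp: power2_eq_square Legendre_mult[OF p(1) p2])
  have "[s\<^sup>2 = -1 * t\<^sup>2] (mod int p)" using dvd by (simp add: cong_iff_dvd_diff)
  then have "Legendre (s\<^sup>2) (int p) = Legendre (-1 * t\<^sup>2) (int p)" by (rule Legendre_cong)
  also have "\<dots> = - (Legendre t (int p) * Legendre t (int p))"
    unfolding Legendre_mult[OF p(1) p2] m1 power2_eq_square by simp
  finally have "- (Legendre t (int p) * Legendre t (int p)) = 1" by (simp only: sq[OF s])
  then show False using Legendre_vals[of t p] by auto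
qed

text \<open>
  Descent: if \<open>p\<close> divides the sum, it divides both \<open>s\<close> and \<open>t\<close>, and \<open>p\<^sup>2\<close> can be cancelled. The sum
  \<open>0\<close> fits in because its multiplicity is \<open>0\<close> by convention.
\<close>
lemma multiplicity_sum_of_two_squares_even:
  assumes p: "prime p" "p mod 4 = 3" and "sum_of_two_squares N"
  shows "even (multiplicity (int p) N)"
proof -
  obtain s t where N: "N = s\<^sup>2 + t\<^sup>2" using assms(3) by (auto simp: sum_of_two_squares_def)
  have pp: "prime (int p)" using p(1) by simp
  have "even (multiplicity (int p) (s\<^sup>2 + t\<^sup>2))"
  proof (induction "nat (s\<^sup>2 + t\<^sup>2)" arbitrary: s t rule: less_induct)
    case less
    show ?case
    proof (cases "int p dvd s\<^sup>2 + t\<^sup>2 \<and> s\<^sup>2 + t\<^sup>2 \<noteq> 0")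
      case False
      then show ?thesis by (auto simp: not_dvd_imp_multiplicity_0)
    next
      case True
      then have "int p dvd s" "int p dvd t"
        using prime_dvd_sum_squares[OF p, of s t] prime_dvd_sum_squares[OF p, of t s]
        by (simp_all add: add.commute)
      then obtain u v where uv: "s = int p * u" "t = int p * v" by (auto elim!: dvdE)
      have eq: "s\<^sup>2 + t\<^sup>2 = int p ^ 2 * (u\<^sup>2 + v\<^sup>2)" by (simp add: uv algebra_simps power_mult_distrib)
      with True have nz: "u\<^sup>2 + v\<^sup>2 \<noteq> 0" by auto
      then have pos: "0 < u\<^sup>2 + v\<^sup>2" using sum_power2_ge_zero[of u v] by linarith
      have "1 < int p ^ 2" using prime_gt_1_nat[OF p(1)] by (intro one_less_power) auto
      then have "u\<^sup>2 + v\<^sup>2 < s\<^sup>2 + t\<^sup>2"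
        unfolding eq using pos by simp
      then have "nat (u\<^sup>2 + v\<^sup>2) < nat (s\<^sup>2 + t\<^sup>2)" using pos by simp
      then have "even (multiplicity (int p) (u\<^sup>2 + v\<^sup>2))" by (rule less)
      moreover have "multiplicity (int p) (s\<^sup>2 + t\<^sup>2) = 2 + multiplicity (int p) (u\<^sup>2 + v\<^sup>2)"
        unfolding eq using pp nz
        by (subst prime_elem_multiplicity_mult_distrib) auto
      ultimately show ?thesis by simp
    qed
  qed
  then show ?thesis by (simp add: N)
qed

section \<open>Non-residues modulo primes congruent to 3 modulo 4\<close>

text \<open>
  The nontrivial character modulo \<open>4\<close>, made to vanish also at the numbers that share a factor with \<open>a\<close>,
  so that it has the same modulus as the character in \<open>quadratic_character_Jacobi\<close>.
\<close>
lemma quadratic_character_mod_4: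
  assumes "0 < a"
  shows "quadratic_character (4 * a) (\<lambda>n. if coprime n (4 * a) then if n mod 4 = 1 then 1 else -1 else 0)"
proof
  fix m n :: nat
  have odd: "k mod 4 = 1 \<or> k mod 4 = 3" if "coprime k (4 * a)" for k :: nat
  proof -
    have "odd k" using that by (auto dest: coprime_common_divisor_nat[where x = 2])
    then show ?thesis by presburger
  qed
  show "(if coprime (m * n) (4 * a) then if (m * n) mod 4 = 1 then 1 else -1 else 0)
      = (if coprime m (4 * a) then if m mod 4 = 1 then 1 else -1 else 0)
        * (if coprime n (4 * a) then if n mod 4 = 1 then 1 else - 1 else (0::real))"
  proof (cases "coprime m (4 * a) \<and> coprime n (4 * a)")
    case True
    then have "(m * n) mod 4 = 1 \<longleftrightarrow> (m mod 4 = 1 \<longleftrightarrow> n mod 4 = 1)"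
      using odd[of m] odd[of n] by (auto simp: mod_mult_eq[of m 4 n, symmetric])
    then show ?thesis using True by (simp del: One_nat_def)
  qed auto
  have "coprime (n + 4 * a) (4 * a) \<longleftrightarrow> coprime n (4 * a)"
    by (simp only: coprime_iff_gcd_eq_1 gcd_add1)
  then show "(if coprime (n + 4 * a) (4 * a) then if (n + 4 * a) mod 4 = 1 then 1 else -1 else 0)
      = (if coprime n (4 * a) then if n mod 4 = 1 then 1 else -1 else (0::real))"
    by simp
  have "coprime (4 * a - 1) (4 * a)"
    using assms coprime_diff_one_left_nat[of "4 * a"] by simp
  moreover have "(4 * a - 1) mod 4 \<noteq> 1"
  proof -
    obtain b where "a = Suc b" using assms by (cases a) auto
    then have "4 * a - 1 = 3 + 4 * b" by simp
    then show ?thesis by simp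
  qed
  ultimately show "\<exists>n. (if coprime n (4 * a) then if n mod 4 = 1 then 1 else -1 else 0) = (-1::real)"
    by (intro exI[of _ "4 * a - 1"]) (simp del: One_nat_def)
qed (use assms in auto)

text \<open>
  Taking \<open>a\<close> as the lower argument makes the period evident. The value at even numbers
  is set to \<open>0\<close> so that the zeros are those of the character in \<open>quadratic_character_mod_4\<close>.
\<close>
lemma quadratic_character_Jacobi:
  assumes "odd a" "\<not> is_square a"
  shows "quadratic_character (4 * a) (\<lambda>n. if odd n then real_of_int (Jacobi n a) else 0)"
proof
  fix m n :: nat
  have a0: "0 < a" using assms(1) by (rule odd_pos)
  show "0 < 4 * a" using a0 by simp
  show "(if odd (m * n) then real_of_int (Jacobi (m * n) a) else 0)
      = (if odd m then real_of_int (Jacobi m a) else 0) * (if odd n then real_of_int (Jacobi n a) else 0)"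
    using assms(1) by (simp add: Jacobi_mult_left)
  show "(if odd n then real_of_int (Jacobi n a) else 0) \<in> {-1, 0, 1}"
    using Jacobi_vals[of n a] by auto
  have "coprime n 4 \<longleftrightarrow> odd n"
    using coprime_power_right_iff[of n 2 2] by (simp add: coprime_right_2_iff_odd)
  then show "((if odd n then real_of_int (Jacobi n a) else 0) = 0) = (\<not> coprime n (4 * a))"
    using Jacobi_eq_0_iff[OF a0, of n] by simp
  have "Jacobi (n + 4 * a) a = Jacobi n a" by (rule Jacobi_cong) (simp add: cong_def)
  then show "(if odd (n + 4 * a) then real_of_int (Jacobi (n + 4 * a) a) else 0)
      = (if odd n then real_of_int (Jacobi n a) else 0)"
    by simp
  obtain k where "odd k" "Jacobi k a = -1" using Jacobi_nontrivial[OF assms] .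
  then show "\<exists>n. (if odd n then real_of_int (Jacobi n a) else 0) = -1"
    by (intro exI[of _ k]) simp
qed

lemma inert_prime_1_mod_4:
  assumes "a mod 4 = 1" "\<not> is_square (a::nat)"
  obtains p where "prime p" "p mod 4 = 3" "Legendre (int a) (int p) = -1"
proof -
  have odd: "odd a" using assms(1) by presburger
  obtain p where p: "prime p"
    "(if coprime p (4 * a) then if p mod 4 = 1 then 1 else -1 else 0) = (-1::real)"
    "(if odd p then real_of_int (Jacobi p a) else 0) = -1"
    using common_prime_value_minus_one[OF quadratic_character_mod_4 quadratic_character_Jacobi[OF odd assms(2)]]
      odd_pos[OF odd] by blast
  have "coprime p a" "p mod 4 \<noteq> 1" "odd p" "Jacobi p a = -1"
    using p(2,3) by (auto split: if_splits)
  moreover from this have "p mod 4 = 3" by presburger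
  ultimately show thesis
    using that[OF p(1)] Jacobi_reciprocity[OF p(1) _ odd] assms(1) by simp
qed

text \<open>
  A prime factor \<open>p \<equiv> 3 (mod 4)\<close> of \<open>x\<^sup>2 + a\<close> works: if \<open>a\<close> were a square \<open>y\<^sup>2\<close> modulo \<open>p\<close>, then \<open>p\<close> would
  divide the sum of squares \<open>x\<^sup>2 + y\<^sup>2\<close>, hence \<open>y\<close> and \<open>a\<close>, contrary to \<open>x\<close> being prime to \<open>a\<close>.
\<close>
lemma inert_prime_via_norm:
  assumes "(x\<^sup>2 + a) mod 4 = 3" "coprime x a"
  obtains p where "prime p" "p mod 4 = 3" "Legendre (int a) (int p) = -1"
proof -
  obtain p where p: "prime p" "p dvd x\<^sup>2 + a" "p mod 4 = 3"
    using prime_3_mod_4_factor[OF assms(1)] .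
  have dvd: "int p dvd (int x)\<^sup>2 + int a" 
    using p(2) int_dvd_int_iff[of p "x\<^sup>2 + a"] by simp
  have nd: "\<not> p dvd a"
  proof
    assume pa: "p dvd a"
    then have "p dvd x" using p by (metis dvd_add_left_iff prime_dvd_power)
    then show False using pa assms(2) p(1) coprime_common_divisor_nat[of x a p] by auto
  qed
  have "Legendre (int a) (int p) \<noteq> 1"
  proof
    assume "Legendre (int a) (int p) = 1"
    then have "QuadRes (int p) (int a)" by (auto simp: Legendre_def split: if_splits)
    then obtain y where y: "[y\<^sup>2 = int a] (mod int p)" by (auto simp: QuadRes_def)
    then have "int p dvd (int x)\<^sup>2 + y\<^sup>2"
      using dvd cong_add[OF cong_refl[of "(int x)\<^sup>2"] y] by (simp add: cong_dvd_iff)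
    then have "int p dvd y" using prime_dvd_sum_squares[OF p(1,3), of y "int x"] by (simp add: add.commute)
    then have "int p dvd y\<^sup>2" by (simp add: power2_eq_square)
    then have "int p dvd int a" using y by (simp add: cong_dvd_iff)
    then show False using nd by simp
  qed
  then have "Legendre (int a) (int p) = -1"
    using Legendre_vals[of a p] nd by (auto simp: Legendre_eq_0_iff)
  then show thesis using that p by blast
qed

lemma inert_prime_exists:
  assumes "0 < a" "\<not> is_square (a::nat)"
  obtains p where "prime p" "p mod 4 = 3" "Legendre (int a) (int p) = -1"
proof -
  have "\<exists>p. prime p \<and> p mod 4 = 3 \<and> Legendre (int a) (int p) = -1"
    using assms
  proof (induction a rule: less_induct)
    case (less a)
    have "a mod 4 < 4" by simp
    then consider "a mod 4 = 0" | "a mod 4 = 1" | "a mod 4 = 2" | "a mod 4 = 3" by linarith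
    then show ?case
    proof cases
      case 1
      then obtain b where b: "a = 4 * b" by (auto simp: mod_eq_0_iff_dvd elim!: dvdE)
      have "\<not> is_square b"
      proof
        assume "is_square b"
        then have "is_square (2\<^sup>2 * b)" by (rule is_nth_power_mult[OF is_nth_power_nth_power])
        then show False using less.prems b by simp
      qed
      then obtain p where p: "prime p" "p mod 4 = 3" "Legendre (int b) (int p) = -1"
        using less.IH[of b] less.prems b by auto
      have p2: "2 < p" using p prime_ge_2_nat[OF p(1)] by (cases "p = 2") auto
      have "int a = 2 * 2 * int b" by (simp add: b)
      then have "Legendre (int a) (int p) = Legendre 2 p * Legendre 2 p * Legendre (int b) (int p)"
        by (simp only: Legendre_mult[OF p(1) p2])
      moreover have "\<not> int p dvd 2" using p2 by (auto dest: zdvd_imp_le)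
      then have "Legendre 2 p * Legendre 2 p = 1"
        using Legendre_vals[of 2 p] Legendre_eq_0_iff[of 2 p] by auto
      ultimately show ?thesis using p by auto
    next
      case 2
      then show ?thesis using inert_prime_1_mod_4 less.prems by metis
    next
      case 3
      then have "(1 + a) mod 4 = 3" by presburger
      then have "(1\<^sup>2 + a) mod 4 = 3" by simp
      then show ?thesis using inert_prime_via_norm[of 1 a] by auto
    next
      case 4
      then have "(2\<^sup>2 + a) mod 4 = 3" by simp
      moreover have "odd a" using 4 by presburger
      ultimately show ?thesis using inert_prime_via_norm[of 2 a] by (auto simp: coprime_left_2_iff_odd)
    qed
  qed
  then show thesis using that by blast
qed

section \<open>Multiplicities in a ^ n + 1\<close>

lemma power_plus_one_factor:
  fixes x :: int
  assumes "odd k"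
  shows "x ^ k + 1 = (x + 1) * (\<Sum>i<k. (- x) ^ i)"
  using one_diff_power_eq[of "- x" k]
  by (simp only: power_minus_odd[OF assms] diff_minus_eq_add add.commute[of 1])

text \<open>
  The cofactor of \<open>x + 1\<close> is a sum of \<open>k\<close> powers of \<open>- x\<close>, each of which is \<open>1\<close> modulo \<open>p\<close>.
\<close>
lemma multiplicity_power_plus_one:
  fixes x :: int
  assumes p: "prime p" and dvd: "int p dvd x + 1" and "x + 1 \<noteq> 0" and k: "odd k" "\<not> p dvd k"
  shows "multiplicity (int p) (x ^ k + 1) = multiplicity (int p) (x + 1)"
proof -
  let ?Q = "\<Sum>i<k. (- x) ^ i"
  have "[- x = 1] (mod int p)" using dvd by (simp add: cong_iff_dvd_diff dvd_diff_commute add.commute)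
  then have "[?Q = (\<Sum>i<k. 1 ^ i)] (mod int p)" by (intro cong_sum cong_pow)
  then have "[?Q = int k] (mod int p)" by simp
  then have Q: "\<not> int p dvd ?Q" using k(2) by (simp add: cong_dvd_iff)
  then have "?Q \<noteq> 0" by auto
  then show ?thesis
    unfolding power_plus_one_factor[OF k(1)] using p assms(3) not_dvd_imp_multiplicity_0[OF Q]
    by (subst prime_elem_multiplicity_mult_distrib) auto
qed

text \<open>
  Modulo \<open>p\<^sup>2\<close> the cofactor of \<open>x + 1 = p * c\<close> is the sum of \<open>1 - i * p * c\<close> over \<open>i < p\<close>. As \<open>p\<close> is odd,
  it divides the sum of the \<open>i\<close>, so the cofactor is \<open>p\<close> modulo \<open>p\<^sup>2\<close>.
\<close>
lemma multiplicity_prime_power_plus_one: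
  fixes x :: int
  assumes p: "prime p" "odd p" and dvd: "int p dvd x + 1" and "x + 1 \<noteq> 0"
  shows "multiplicity (int p) (x ^ p + 1) = Suc (multiplicity (int p) (x + 1))"
proof -
  let ?Q = "\<Sum>i<p. (- x) ^ i"
  obtain c where c: "x + 1 = int p * c" using dvd by (auto elim!: dvdE)
  then have x: "- x = 1 - int p * c" by simp
  have pw: "[(- x) ^ i = 1 - int i * (int p * c)] (mod (int p)\<^sup>2)" for i
  proof (induction i)
    case (Suc i)
    have "[(- x) ^ Suc i = (1 - int p * c) * (1 - int i * (int p * c))] (mod (int p)\<^sup>2)"
      unfolding power_Suc x[symmetric] by (intro cong_mult Suc cong_refl)
    also have "(1 - int p * c) * (1 - int i * (int p * c))
        = 1 - int (Suc i) * (int p * c) + (int p)\<^sup>2 * (int i * c\<^sup>2)"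
      by (simp add: algebra_simps power2_eq_square)
    also have "[\<dots> = 1 - int (Suc i) * (int p * c)] (mod (int p)\<^sup>2)"
      by (simp add: cong_iff_dvd_diff)
    finally show ?case .
  qed simp
  have "[?Q = (\<Sum>i<p. 1 - int i * (int p * c))] (mod (int p)\<^sup>2)"
    by (intro cong_sum pw)
  also have "(\<Sum>i<p. 1 - int i * (int p * c)) = int p - (\<Sum>i<p. int i) * (int p * c)"
    by (simp add: sum_subtractf sum_distrib_right)
  also have "(\<Sum>i<p. int i) = int p * ((int p - 1) div 2)"
  proof -
    have "2 * (\<Sum>i<n. int i) = int n * (int n - 1)" for n
      by (induction n) (simp_all add: algebra_simps)
    moreover have "2 * ((int p - 1) div 2) = int p - 1" using p(2) by simp
    ultimately have "2 * (\<Sum>i<p. int i) = 2 * (int p * ((int p - 1) div 2))"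
      by (metis mult.left_commute)
    then show ?thesis by simp
  qed
  also have "[int p - int p * ((int p - 1) div 2) * (int p * c) = int p] (mod (int p)\<^sup>2)"
    by (simp add: cong_iff_dvd_diff power2_eq_square mult_ac)
  finally have Q: "[?Q = int p] (mod (int p)\<^sup>2)" .
  have "int p dvd ?Q"
    using cong_dvd_modulus[OF Q, of "int p"] by (simp add: cong_dvd_iff)
  moreover have "\<not> (int p)\<^sup>2 dvd ?Q"
    using Q prime_gt_1_nat[OF p(1)] zdvd_not_zless[of "int p" "(int p)\<^sup>2"]
    by (simp add: cong_dvd_iff power2_eq_square)
  ultimately have mQ: "multiplicity (int p) ?Q = 1"
    by (intro multiplicity_eqI) (simp_all add: numeral_2_eq_2)
  then have "?Q \<noteq> 0" by (metis multiplicity_zero zero_neq_one)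
  then show ?thesis
    unfolding power_plus_one_factor[OF p(2)] using p assms(4) mQ
    by (subst prime_elem_multiplicity_mult_distrib) auto
qed

lemma infinitely_many_exponents:
  fixes a :: int
  assumes "a > 0" and p: "prime p" "p mod 4 = 3" and L: "Legendre a (int p) = -1"
  shows "infinite {n :: nat. n > 0 \<and> odd n \<and> \<not> sum_of_two_squares (a ^ n + 1)}"
proof -
  have p2: "2 < p" using p prime_ge_2_nat[OF p(1)] by (cases "p = 2") auto
  have oddp: "odd p" using p(2) by presburger
  define m where "m = (p - 1) div 2"
  have m: "odd m" unfolding m_def using p(2) by presburger
  have nz: "a ^ n + 1 \<noteq> 0" for n using zero_less_power[OF assms(1), of n] by linarith
  have dvd: "int p dvd a ^ m + 1"
    using euler_criterion[OF p(1) p2, of a] L unfolding m_def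
    by (simp add: cong_iff_dvd_diff dvd_diff_commute[of _ "-1"])
  obtain n0 where n0: "odd n0" "int p dvd a ^ n0 + 1" "odd (multiplicity (int p) (a ^ n0 + 1))"
  proof (cases "odd (multiplicity (int p) (a ^ m + 1))")
    case True
    then show ?thesis using that m dvd by blast
  next
    case False
    have mult: "multiplicity (int p) (a ^ (m * p) + 1) = Suc (multiplicity (int p) (a ^ m + 1))"
      unfolding power_mult by (rule multiplicity_prime_power_plus_one[OF p(1) oddp dvd nz])
    moreover from this have "int p dvd a ^ (m * p) + 1"
      by (metis dvd_power multiplicity_dvd dvd_trans zero_less_Suc)
    ultimately show ?thesis using that[of "m * p"] False m oddp by simp
  qed
  \<comment> \<open>the multipliers \<open>1 + 2 * p * j\<close> are odd and prime to \<open>p\<close>\<close>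
  have "n0 * (1 + 2 * p * j) \<in> {n. n > 0 \<and> odd n \<and> \<not> sum_of_two_squares (a ^ n + 1)}" for j
  proof -
    have "\<not> p dvd 1 + 2 * p * j"
    proof
      assume "p dvd 1 + 2 * p * j"
      then have "p dvd 1" by (metis dvd_add_left_iff dvd_mult dvd_mult2 dvd_refl mult.assoc dvd_triv_left)
      then show False using p2 by simp
    qed
    then have "multiplicity (int p) (a ^ (n0 * (1 + 2 * p * j)) + 1) = multiplicity (int p) (a ^ n0 + 1)"
      unfolding power_mult by (intro multiplicity_power_plus_one p(1) n0 nz) auto
    then have "\<not> sum_of_two_squares (a ^ (n0 * (1 + 2 * p * j)) + 1)"
      using n0(3) multiplicity_sum_of_two_squares_even[OF p] by metis
    then show ?thesis using n0(1) by (auto simp: odd_pos)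
  qed
  then have "range (\<lambda>j. n0 * (1 + 2 * p * j)) \<subseteq> {n. n > 0 \<and> odd n \<and> \<not> sum_of_two_squares (a ^ n + 1)}"
    by blast
  moreover have "inj (\<lambda>j. n0 * (1 + 2 * p * j))"
    using n0(1) p2 by (auto intro!: injI)
  ultimately show ?thesis by (meson infinite_super range_inj_infinite)
qed

theorem mainTheorem10:
  fixes a :: int
  assumes "a > 0"
    and "\<not> is_square a"
  shows "infinite {n :: nat. n > 0 \<and> odd n \<and> \<not> sum_of_two_squares (a ^ n + 1)}"
proof -
  obtain b where b: "a = int b" "0 < b" using assms(1) by (metis zero_less_imp_eq_int)
  have "\<not> is_square b"
  proof
    assume "is_square b"
    then obtain y where "b = y\<^sup>2" by (rule is_nth_powerE)
    then have "a = (int y)\<^sup>2" by (simp add: b)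
    then show False using assms(2) by simp
  qed
  then obtain p where "prime p" "p mod 4 = 3" "Legendre (int b) (int p) = -1"
    using inert_prime_exists[OF b(2)] by blast
  then show ?thesis using infinitely_many_exponents[OF assms(1)] b(1) by blast
qed

end
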